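(* Let $R$ be a ring and $n$ a positive integer such that there exists a lattice duality (lattice anti-isomorphism) $l\colon \mathcal{L}(R^n_R)\to \mathcal{L}({}_RR^n)$, and let $r\colon \mathcal{L}({}_RR^n)\to\mathcal{L}(R^n_R)$ be its inverse. Let $C\leq R^n$ be a two-sided code (an $(R\text{-}R)$-subbimodule of $R^n$) such that $l(C)\cap C=0=C\cap r(C)$. Then $C$ is projective both as a right and as a left $R$-module. In particular, if $R$ is a local ring, then $C$ is free.
   Context: Rings are associative with unity, not necessarily commutative. $\mathcal{L}(R^n_R)$ denotes the lattice of right $R$-submodules of $R^n$ and $\mathcal{L}({}_RR^n)$ the lattice of left $R$-submodules of $R^n$. A lattice duality is an order-reversing bijection between lattices whose inverse is also order-reversing (hence it exchanges sums and intersections). A free module here means one isomorphic to $R^s$ for some $s\ge 0$ (the zero module is regarded as free of rank $0$). *)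

theory Defs
  imports "HOL-Algebra.Algebra"
begin

text \<open>
  The library locale \<open>module\<close> requires a commutative scalar ring; the following is the same
  axiomatisation over an arbitrary ring. Right \<open>R\<close>-modules are left modules over the opposite
  ring of \<open>R\<close>, so that \<open>a \<odot>\<^bsub>M\<^esub> x\<close> then denotes the right action \<open>x a\<close>.
\<close>

locale left_module = R?: ring R + M?: abelian_group M
  for R :: "('a, 'r) ring_scheme" (structure)
    and M :: "('a, 'b, 'c) module_scheme" (structure) +
  assumes smult_closed:
      "\<lbrakk>a \<in> carrier R; x \<in> carrier M\<rbrakk> \<Longrightarrow> a \<odot>\<^bsub>M\<^esub> x \<in> carrier M"
    and smult_l_distr:
      "\<lbrakk>a \<in> carrier R; b \<in> carrier R; x \<in> carrier M\<rbrakk> \<Longrightarrow>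
       (a \<oplus>\<^bsub>R\<^esub> b) \<odot>\<^bsub>M\<^esub> x = a \<odot>\<^bsub>M\<^esub> x \<oplus>\<^bsub>M\<^esub> b \<odot>\<^bsub>M\<^esub> x"
    and smult_r_distr:
      "\<lbrakk>a \<in> carrier R; x \<in> carrier M; y \<in> carrier M\<rbrakk> \<Longrightarrow>
       a \<odot>\<^bsub>M\<^esub> (x \<oplus>\<^bsub>M\<^esub> y) = a \<odot>\<^bsub>M\<^esub> x \<oplus>\<^bsub>M\<^esub> a \<odot>\<^bsub>M\<^esub> y"
    and smult_assoc:
      "\<lbrakk>a \<in> carrier R; b \<in> carrier R; x \<in> carrier M\<rbrakk> \<Longrightarrow>
       (a \<otimes>\<^bsub>R\<^esub> b) \<odot>\<^bsub>M\<^esub> x = a \<odot>\<^bsub>M\<^esub> (b \<odot>\<^bsub>M\<^esub> x)"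
    and smult_one:
      "x \<in> carrier M \<Longrightarrow> \<one>\<^bsub>R\<^esub> \<odot>\<^bsub>M\<^esub> x = x"

definition opp :: "('a, 'r) ring_scheme \<Rightarrow> ('a, 'r) ring_scheme" where
  "opp R = R\<lparr>monoid.mult := (\<lambda>a b. b \<otimes>\<^bsub>R\<^esub> a)\<rparr>"

text \<open>
  \<open>R\<^sup>n\<close> as a left module, its elements being the extensional functions on \<open>{..<n}\<close>. The fields
  \<open>mult\<close> and \<open>one\<close> of the record type play no role for modules.
\<close>

definition left_pow :: "('a, 'r) ring_scheme \<Rightarrow> nat \<Rightarrow> ('a, nat \<Rightarrow> 'a) module" where
  "left_pow R n =
     \<lparr>carrier = {..<n} \<rightarrow>\<^sub>E carrier R,
      monoid.mult = undefined, one = undefined,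
      ring.zero = (\<lambda>i\<in>{..<n}. \<zero>\<^bsub>R\<^esub>),
      ring.add = (\<lambda>v w. \<lambda>i\<in>{..<n}. v i \<oplus>\<^bsub>R\<^esub> w i),
      smult = (\<lambda>a v. \<lambda>i\<in>{..<n}. a \<otimes>\<^bsub>R\<^esub> v i)\<rparr>"

definition right_pow :: "('a, 'r) ring_scheme \<Rightarrow> nat \<Rightarrow> ('a, nat \<Rightarrow> 'a) module" where
  "right_pow R n = left_pow (opp R) n"

definition left_submodules ::
  "('a, 'r) ring_scheme \<Rightarrow> ('a, 'b, 'c) module_scheme \<Rightarrow> 'b set set" where
  "left_submodules R M = {H. submodule H R M}"

definition right_submodules ::
  "('a, 'r) ring_scheme \<Rightarrow> ('a, 'b, 'c) module_scheme \<Rightarrow> 'b set set" where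
  "right_submodules R M = left_submodules (opp R) M"

definition lattice_duality :: "'b set set \<Rightarrow> 'c set set \<Rightarrow> ('b set \<Rightarrow> 'c set) \<Rightarrow> bool" where
  "lattice_duality L L' l \<longleftrightarrow>
     bij_betw l L L' \<and> antimono_on L l \<and> antimono_on L' (inv_into L l)"

definition mod_hom ::
  "('a, 'r) ring_scheme \<Rightarrow> ('a, 'b, 'c) module_scheme \<Rightarrow> ('a, 'd, 'e) module_scheme
    \<Rightarrow> ('b \<Rightarrow> 'd) set" where
  "mod_hom R M N =
     {h \<in> carrier M \<rightarrow> carrier N.
        (\<forall>x\<in>carrier M. \<forall>y\<in>carrier M. h (x \<oplus>\<^bsub>M\<^esub> y) = h x \<oplus>\<^bsub>N\<^esub> h y) \<and>
        (\<forall>a\<in>carrier R. \<forall>x\<in>carrier M. h (a \<odot>\<^bsub>M\<^esub> x) = a \<odot>\<^bsub>N\<^esub> h x)}"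

text \<open>
  Projectivity by the lifting property. A definition cannot quantify over types, so the element
  types \<open>'m\<close> and \<open>'k\<close> of the test modules are explicit parameters; a module is projective if
  this holds for all types \<open>'m\<close> and \<open>'k\<close>, which is what a theorem with these type variables
  free asserts.
\<close>

definition left_projective ::
  "'m itself \<Rightarrow> 'k itself \<Rightarrow> ('a, 'r) ring_scheme \<Rightarrow> ('a, 'b, 'c) module_scheme \<Rightarrow> bool" where
  "left_projective _ _ R P \<longleftrightarrow>
     left_module R P \<and>
     (\<forall>(M :: ('a, 'm) module) (N :: ('a, 'k) module) g f.
        left_module R M \<longrightarrow> left_module R N \<longrightarrow>
        g \<in> mod_hom R M N \<longrightarrow> g ` carrier M = carrier N \<longrightarrow> f \<in> mod_hom R P N \<longrightarrow>
        (\<exists>h\<in>mod_hom R P M. \<forall>x\<in>carrier P. g (h x) = f x))"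

definition right_projective ::
  "'m itself \<Rightarrow> 'k itself \<Rightarrow> ('a, 'r) ring_scheme \<Rightarrow> ('a, 'b, 'c) module_scheme \<Rightarrow> bool" where
  "right_projective m k R P \<longleftrightarrow> left_projective m k (opp R) P"

text \<open>Free of finite rank; rank \<open>0\<close>, that is the zero module, is allowed.\<close>

definition left_free :: "('a, 'r) ring_scheme \<Rightarrow> ('a, 'b, 'c) module_scheme \<Rightarrow> bool" where
  "left_free R P \<longleftrightarrow>
     left_module R P \<and>
     (\<exists>s. \<exists>h\<in>mod_hom R (left_pow R s) P.
        bij_betw h (carrier (left_pow R s)) (carrier P))"

definition right_free :: "('a, 'r) ring_scheme \<Rightarrow> ('a, 'b, 'c) module_scheme \<Rightarrow> bool" where
  "right_free R P \<longleftrightarrow> left_free (opp R) P"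

definition left_ideal :: "'a set \<Rightarrow> ('a, 'r) ring_scheme \<Rightarrow> bool" where
  "left_ideal I R \<longleftrightarrow>
     additive_subgroup I R \<and> (\<forall>a\<in>carrier R. \<forall>x\<in>I. a \<otimes>\<^bsub>R\<^esub> x \<in> I)"

definition maximal_left_ideal :: "'a set \<Rightarrow> ('a, 'r) ring_scheme \<Rightarrow> bool" where
  "maximal_left_ideal I R \<longleftrightarrow>
     left_ideal I R \<and> I \<noteq> carrier R \<and>
     (\<forall>J. left_ideal J R \<longrightarrow> I \<subseteq> J \<longrightarrow> J = I \<or> J = carrier R)"

text \<open>
  This notion is left-right symmetric (the unique maximal left ideal is then also the unique
  maximal right ideal), and excludes the zero ring.
\<close>

definition local_ring :: "('a, 'r) ring_scheme \<Rightarrow> bool" where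
  "local_ring R \<longleftrightarrow> ring R \<and> (\<exists>!I. maximal_left_ideal I R)"

lemma opp_simps [simp]:
  "carrier (opp R) = carrier R" "\<one>\<^bsub>opp R\<^esub> = \<one>\<^bsub>R\<^esub>" "\<zero>\<^bsub>opp R\<^esub> = \<zero>\<^bsub>R\<^esub>"
  "a \<oplus>\<^bsub>opp R\<^esub> b = a \<oplus>\<^bsub>R\<^esub> b" "a \<otimes>\<^bsub>opp R\<^esub> b = b \<otimes>\<^bsub>R\<^esub> a" "opp (opp R) = R"
  by (simp_all add: opp_def)

lemma right_pow_smult:
  "a \<odot>\<^bsub>right_pow R n\<^esub> v = (\<lambda>i\<in>{..<n}. v i \<otimes>\<^bsub>R\<^esub> a)"
  by (simp add: right_pow_def left_pow_def)

lemma (in ring) ring_opp: "ring (opp R)"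
proof (rule ringI)
  show "abelian_group (opp R)"
  proof (rule abelian_groupI)
    fix x assume "x \<in> carrier (opp R)"
    then show "\<exists>y\<in>carrier (opp R). y \<oplus>\<^bsub>opp R\<^esub> x = \<zero>\<^bsub>opp R\<^esub>"
      by (intro bexI[of _ "\<ominus> x"]) (auto simp: l_neg)
  qed (auto simp: a_ac)
  show "Group.monoid (opp R)"
    by (rule monoidI) (auto simp: m_assoc)
qed (auto simp: l_distr r_distr)

lemma (in ring) left_module_left_pow: "left_module R (left_pow R n)"
proof (intro left_module.intro left_module_axioms.intro)
  show "ring R" by (rule ring_axioms)
  show "abelian_group (left_pow R n)"
  proof (rule abelian_groupI)
    fix x assume "x \<in> carrier (left_pow R n)"
    then show "\<exists>y\<in>carrier (left_pow R n). y \<oplus>\<^bsub>left_pow R n\<^esub> x = \<zero>\<^bsub>left_pow R n\<^esub>"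
      by (intro bexI[of _ "\<lambda>i\<in>{..<n}. \<ominus> x i"])
         (auto simp: left_pow_def PiE_iff extensional_def fun_eq_iff restrict_def l_neg)
  qed (auto simp: left_pow_def PiE_iff extensional_def fun_eq_iff restrict_def a_ac)
qed (auto simp: left_pow_def PiE_iff extensional_def fun_eq_iff restrict_def
       l_distr r_distr m_assoc)

lemma (in ring) left_module_right_pow: "left_module (opp R) (right_pow R n)"
  unfolding right_pow_def by (rule ring.left_module_left_pow[OF ring_opp])

end

theory Submission
  imports Defs
begin

text \<open>
  A duality turns \<open>l(C) \<inter> C = 0\<close> and \<open>C \<inter> r(C) = 0\<close> into \<open>C + r(C) = R\<^sup>n\<close> (right modules) and
  \<open>C + l(C) = R\<^sup>n\<close> (left modules), because \<open>l(C + r(C)) \<subseteq> l(C) \<inter> C\<close> and dually. So \<open>C\<close> is a direct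
  summand of \<open>R\<^sup>n\<close> on both sides, hence projective.

  Let \<open>R\<close> be local and \<open>M = P \<oplus> Q\<close> with a finite basis of \<open>M\<close>. Writing a basis vector \<open>b\<^sub>k\<close> as
  \<open>p + q\<close>, the \<open>k\<close>-th coordinates of \<open>p\<close> and \<open>q\<close> add up to \<open>1\<close>, so one of them is a unit and \<open>b\<^sub>k\<close>
  may be exchanged for \<open>p\<close> or \<open>q\<close>. In the end every basis vector lies in \<open>P\<close> or in \<open>Q\<close>, and those
  in \<open>P\<close> form a basis of \<open>P\<close>. A basis is encoded as a linear bijection from \<open>R\<^sup>n\<close>.
\<close>

section \<open>Modules and linear maps\<close>

context left_module
begin

lemma smult_l_null: "x \<in> carrier M \<Longrightarrow> \<zero>\<^bsub>R\<^esub> \<odot>\<^bsub>M\<^esub> x = \<zero>\<^bsub>M\<^esub>"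
  using smult_l_distr[of "\<zero>\<^bsub>R\<^esub>" "\<zero>\<^bsub>R\<^esub>" x] smult_closed[of "\<zero>\<^bsub>R\<^esub>" x]
  by (metis M.add.l_cancel_one R.l_zero R.zero_closed)

lemma smult_r_null: "a \<in> carrier R \<Longrightarrow> a \<odot>\<^bsub>M\<^esub> \<zero>\<^bsub>M\<^esub> = \<zero>\<^bsub>M\<^esub>"
  using smult_r_distr[of a "\<zero>\<^bsub>M\<^esub>" "\<zero>\<^bsub>M\<^esub>"] smult_closed[of a "\<zero>\<^bsub>M\<^esub>"]
  by (metis M.add.l_cancel_one M.l_zero M.zero_closed)

lemma smult_minus_one:
  assumes "x \<in> carrier M"
  shows "(\<ominus>\<^bsub>R\<^esub> \<one>\<^bsub>R\<^esub>) \<odot>\<^bsub>M\<^esub> x = \<ominus>\<^bsub>M\<^esub> x"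
proof -
  have "(\<ominus>\<^bsub>R\<^esub> \<one>\<^bsub>R\<^esub>) \<odot>\<^bsub>M\<^esub> x \<oplus>\<^bsub>M\<^esub> x = \<zero>\<^bsub>M\<^esub>"
    using smult_l_distr[of "\<ominus>\<^bsub>R\<^esub> \<one>\<^bsub>R\<^esub>" "\<one>\<^bsub>R\<^esub>" x] assms
    by (simp add: smult_one smult_l_null R.l_neg)
  then show ?thesis
    using assms smult_closed by (intro M.minus_equality[symmetric]) auto
qed

text \<open>Negation is scaling by -1, so closure under it follows from closure under scalars and is
  left out of the criterion.\<close>

lemma submodule_iff:
  "submodule H R M \<longleftrightarrow> H \<subseteq> carrier M \<and> \<zero>\<^bsub>M\<^esub> \<in> H \<and>
     (\<forall>x\<in>H. \<forall>y\<in>H. x \<oplus>\<^bsub>M\<^esub> y \<in> H) \<and> (\<forall>a\<in>carrier R. \<forall>x\<in>H. a \<odot>\<^bsub>M\<^esub> x \<in> H)"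
    (is "_ \<longleftrightarrow> ?rhs")
proof
  assume "submodule H R M"
  then interpret submodule H R M .
  show ?rhs
    using subset one_closed m_closed smult_closed by auto
next
  assume rhs: ?rhs
  have "\<ominus>\<^bsub>M\<^esub> x \<in> H" if "x \<in> H" for x
    using rhs that smult_minus_one[of x] R.a_inv_closed[OF R.one_closed] by (metis subsetD)
  then show "submodule H R M"
    using rhs by (auto simp: submodule_def subgroup_def submodule_axioms_def a_inv_def)
qed

lemma submodule_minus:
  assumes "submodule H R M" and "x \<in> H"
  shows "\<ominus>\<^bsub>M\<^esub> x \<in> H"
  using assms smult_minus_one[of x] R.a_inv_closed[OF R.one_closed]
  unfolding submodule_iff by (metis subsetD)

lemma submodule_carrier: "submodule (carrier M) R M"
  by (simp add: submodule_iff smult_closed)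

lemma left_module_submodule:
  assumes "submodule H R M"
  shows "left_module R (M\<lparr>carrier := H\<rparr>)"
proof (intro left_module.intro left_module_axioms.intro)
  show "abelian_group (M\<lparr>carrier := H\<rparr>)"
  proof (rule abelian_groupI)
    fix x assume "x \<in> carrier (M\<lparr>carrier := H\<rparr>)"
    then show "\<exists>y\<in>carrier (M\<lparr>carrier := H\<rparr>). y \<oplus>\<^bsub>M\<lparr>carrier := H\<rparr>\<^esub> x = \<zero>\<^bsub>M\<lparr>carrier := H\<rparr>\<^esub>"
      using assms submodule_minus[OF assms, of x]
      by (intro bexI[of _ "\<ominus>\<^bsub>M\<^esub> x"]) (auto simp: M.l_neg submodule_iff)
  qed (use assms in \<open>auto simp: submodule_iff M.a_ac subset_iff\<close>)
qed (use assms R.ring_axioms in \<open>auto simp: submodule_iff subset_iff smult_l_distr smult_r_distr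
       smult_assoc smult_one\<close>)

lemma submodule_sum:
  assumes "submodule P R M" and "submodule Q R M"
  shows "submodule (P <+>\<^bsub>M\<^esub> Q) R M"
    and "P \<subseteq> P <+>\<^bsub>M\<^esub> Q" and "Q \<subseteq> P <+>\<^bsub>M\<^esub> Q"
proof -
  have P: "P \<subseteq> carrier M" "\<zero>\<^bsub>M\<^esub> \<in> P" "\<And>x y. x \<in> P \<Longrightarrow> y \<in> P \<Longrightarrow> x \<oplus>\<^bsub>M\<^esub> y \<in> P"
      "\<And>a x. a \<in> carrier R \<Longrightarrow> x \<in> P \<Longrightarrow> a \<odot>\<^bsub>M\<^esub> x \<in> P"
    and Q: "Q \<subseteq> carrier M" "\<zero>\<^bsub>M\<^esub> \<in> Q" "\<And>x y. x \<in> Q \<Longrightarrow> y \<in> Q \<Longrightarrow> x \<oplus>\<^bsub>M\<^esub> y \<in> Q"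
      "\<And>a x. a \<in> carrier R \<Longrightarrow> x \<in> Q \<Longrightarrow> a \<odot>\<^bsub>M\<^esub> x \<in> Q"
    using assms by (auto simp: submodule_iff)
  have mem: "z \<in> P <+>\<^bsub>M\<^esub> Q \<longleftrightarrow> (\<exists>p\<in>P. \<exists>q\<in>Q. z = p \<oplus>\<^bsub>M\<^esub> q)" for z
    by (simp add: set_add_def set_mult_def)
  show "P \<subseteq> P <+>\<^bsub>M\<^esub> Q"
    using P(1) Q(2) by (force simp: mem)
  show "Q \<subseteq> P <+>\<^bsub>M\<^esub> Q"
    using Q(1) P(2) by (force simp: mem)
  have add: "x \<oplus>\<^bsub>M\<^esub> y \<in> P <+>\<^bsub>M\<^esub> Q" if "x \<in> P <+>\<^bsub>M\<^esub> Q" "y \<in> P <+>\<^bsub>M\<^esub> Q" for x y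
  proof -
    obtain p q p' q' where "p \<in> P" "q \<in> Q" "x = p \<oplus>\<^bsub>M\<^esub> q" "p' \<in> P" "q' \<in> Q" "y = p' \<oplus>\<^bsub>M\<^esub> q'"
      using \<open>x \<in> _\<close> \<open>y \<in> _\<close> by (auto simp: mem)
    moreover from this have "x \<oplus>\<^bsub>M\<^esub> y = (p \<oplus>\<^bsub>M\<^esub> p') \<oplus>\<^bsub>M\<^esub> (q \<oplus>\<^bsub>M\<^esub> q')"
      using P(1) Q(1) by (simp add: M.a_ac subset_iff)
    ultimately show ?thesis
      unfolding mem using P(3) Q(3)
      by (intro bexI[of _ "p \<oplus>\<^bsub>M\<^esub> p'"] bexI[of _ "q \<oplus>\<^bsub>M\<^esub> q'"])
  qed
  have smult: "a \<odot>\<^bsub>M\<^esub> x \<in> P <+>\<^bsub>M\<^esub> Q" if "a \<in> carrier R" "x \<in> P <+>\<^bsub>M\<^esub> Q" for a x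
  proof -
    obtain p q where "p \<in> P" "q \<in> Q" "x = p \<oplus>\<^bsub>M\<^esub> q"
      using \<open>x \<in> _\<close> by (auto simp: mem)
    moreover from this have "a \<odot>\<^bsub>M\<^esub> x = a \<odot>\<^bsub>M\<^esub> p \<oplus>\<^bsub>M\<^esub> a \<odot>\<^bsub>M\<^esub> q"
      using P(1) Q(1) that(1) by (simp add: smult_r_distr subset_iff)
    ultimately show ?thesis
      unfolding mem using P(4) Q(4) that(1)
      by (intro bexI[of _ "a \<odot>\<^bsub>M\<^esub> p"] bexI[of _ "a \<odot>\<^bsub>M\<^esub> q"])
  qed
  have "P <+>\<^bsub>M\<^esub> Q \<subseteq> carrier M"
    using P(1) Q(1) by (auto simp: mem subset_iff)
  moreover have "\<zero>\<^bsub>M\<^esub> \<in> P <+>\<^bsub>M\<^esub> Q"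
    using P(2) \<open>P \<subseteq> P <+>\<^bsub>M\<^esub> Q\<close> by auto
  ultimately show "submodule (P <+>\<^bsub>M\<^esub> Q) R M"
    using add smult by (auto simp: submodule_iff)
qed

end

section \<open>Linear maps\<close>

lemma mod_homD:
  assumes "h \<in> mod_hom R M N"
  shows "\<And>x. x \<in> carrier M \<Longrightarrow> h x \<in> carrier N"
    and "\<And>x y. x \<in> carrier M \<Longrightarrow> y \<in> carrier M \<Longrightarrow> h (x \<oplus>\<^bsub>M\<^esub> y) = h x \<oplus>\<^bsub>N\<^esub> h y"
    and "\<And>a x. a \<in> carrier R \<Longrightarrow> x \<in> carrier M \<Longrightarrow> h (a \<odot>\<^bsub>M\<^esub> x) = a \<odot>\<^bsub>N\<^esub> h x"
  using assms by (auto simp: mod_hom_def)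

lemma mod_hom_compose:
  assumes "f \<in> mod_hom R L M" and "g \<in> mod_hom R M N"
  shows "g \<circ> f \<in> mod_hom R L N"
  using assms by (auto simp: mod_hom_def Pi_iff)

lemma mod_hom_zero:
  assumes "left_module R M" and "left_module R N" and "h \<in> mod_hom R M N"
  shows "h \<zero>\<^bsub>M\<^esub> = \<zero>\<^bsub>N\<^esub>"
proof -
  interpret M: left_module R M by fact
  interpret N: left_module R N by fact
  have "h (\<zero>\<^bsub>R\<^esub> \<odot>\<^bsub>M\<^esub> \<zero>\<^bsub>M\<^esub>) = \<zero>\<^bsub>R\<^esub> \<odot>\<^bsub>N\<^esub> h \<zero>\<^bsub>M\<^esub>"
    by (simp add: mod_homD[OF assms(3)])
  then show ?thesis
    by (simp add: M.smult_l_null N.smult_l_null mod_homD[OF assms(3)])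
qed

text \<open>Serves as a uniqueness principle: if two linear maps agree on generators, this submodule
  contains the generators and is therefore everything.\<close>

lemma submodule_equalizer:
  assumes "left_module R M" and "left_module R N"
    and "f \<in> mod_hom R M N" and "g \<in> mod_hom R M N"
  shows "submodule {x \<in> carrier M. f x = g x} R M"
proof -
  interpret M: left_module R M by fact
  show ?thesis
    by (auto simp: M.submodule_iff M.smult_closed mod_homD[OF assms(3)] mod_homD[OF assms(4)]
        mod_hom_zero[OF assms(1-3)] mod_hom_zero[OF assms(1,2,4)])
qed

section \<open>The standard basis\<close>

text \<open>For \<open>k \<ge> n\<close> the formula gives the zero vector, so it lies in R^n for
  every \<open>k\<close>.\<close>

definition std_vec :: "('a, 'r) ring_scheme \<Rightarrow> nat \<Rightarrow> nat \<Rightarrow> nat \<Rightarrow> 'a" where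
  "std_vec R n k = (\<lambda>i\<in>{..<n}. if i = k then \<one>\<^bsub>R\<^esub> else \<zero>\<^bsub>R\<^esub>)"

lemma left_pow_simps:
  "carrier (left_pow R n) = {..<n} \<rightarrow>\<^sub>E carrier R"
  "\<zero>\<^bsub>left_pow R n\<^esub> = (\<lambda>i\<in>{..<n}. \<zero>\<^bsub>R\<^esub>)"
  "v \<oplus>\<^bsub>left_pow R n\<^esub> w = (\<lambda>i\<in>{..<n}. v i \<oplus>\<^bsub>R\<^esub> w i)"
  "a \<odot>\<^bsub>left_pow R n\<^esub> v = (\<lambda>i\<in>{..<n}. a \<otimes>\<^bsub>R\<^esub> v i)"
  by (simp_all add: left_pow_def)

lemma (in ring) std_vec_closed: "std_vec R n k \<in> carrier (left_pow R n)"
  by (simp add: std_vec_def left_pow_simps)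

context left_module
begin

text \<open>Induction on the support \<open>S\<close>, splitting off one coordinate at a time. With
  \<open>h = id\<close> it shows that a submodule containing all standard vectors is all of R^n;
  with fewer indices it places the span of part of a basis in a summand.\<close>

lemma hom_image_supported:
  assumes P: "submodule P R M" and h: "h \<in> mod_hom R (left_pow R n) M"
    and "finite S" and "\<And>i. i \<in> S \<Longrightarrow> i < n \<Longrightarrow> h (std_vec R n i) \<in> P"
    and "v \<in> carrier (left_pow R n)" and "\<And>i. i < n \<Longrightarrow> i \<notin> S \<Longrightarrow> v i = \<zero>\<^bsub>R\<^esub>"
  shows "h v \<in> P"
  using assms(3-6)
proof (induction S arbitrary: v rule: finite_induct)
  case empty
  then have "v = \<zero>\<^bsub>left_pow R n\<^esub>"
    by (auto simp: left_pow_simps PiE_iff extensional_def fun_eq_iff)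
  then show ?case
    using mod_hom_zero[OF R.left_module_left_pow left_module_axioms h] P
    by (simp add: submodule_iff)
next
  case (insert k S)
  show ?case
  proof (cases "k < n")
    \<comment> \<open>An index beyond the range names no coordinate, so the support condition
      already holds for \<open>S\<close>.\<close>
    case False
    show ?thesis
    proof (rule insert.IH)
      show "h (std_vec R n i) \<in> P" if "i \<in> S" "i < n" for i
        using insert.prems(1)[of i] that by simp
      show "v i = \<zero>\<^bsub>R\<^esub>" if "i < n" "i \<notin> S" for i
        using insert.prems(3)[of i] that False by (cases "i = k") simp_all
    qed (rule insert.prems(2))
  next
    case True
    \<comment> \<open>\<open>w\<close> erases coordinate \<open>k\<close>, hence is supported on
      \<open>S\<close>; adding \<open>v k\<close> times the standard vector restores
      \<open>v\<close>.\<close>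
    define w where "w = v(k := \<zero>\<^bsub>R\<^esub>)"
    have w: "w \<in> carrier (left_pow R n)"
      using insert.prems(2) True by (auto simp: w_def left_pow_simps PiE_iff extensional_def)
    have vk: "v k \<in> carrier R"
      using insert.prems(2) True by (auto simp: left_pow_simps)
    have v: "v = w \<oplus>\<^bsub>left_pow R n\<^esub> v k \<odot>\<^bsub>left_pow R n\<^esub> std_vec R n k"
      using insert.prems(2) True
      by (auto simp: w_def left_pow_simps std_vec_def PiE_iff extensional_def fun_eq_iff)
    have "h v = h w \<oplus>\<^bsub>M\<^esub> v k \<odot>\<^bsub>M\<^esub> h (std_vec R n k)"
      by (subst v) (simp add: mod_homD[OF h] w vk R.std_vec_closed
          left_module.smult_closed[OF R.left_module_left_pow])
    moreover have "h w \<in> P"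
    proof (rule insert.IH)
      show "h (std_vec R n i) \<in> P" if "i \<in> S" "i < n" for i
        using insert.prems(1)[of i] that by simp
      show "w i = \<zero>\<^bsub>R\<^esub>" if "i < n" "i \<notin> S" for i
        using insert.prems(3)[of i] that by (cases "i = k") (simp_all add: w_def)
    qed (rule w)
    moreover have "h (std_vec R n k) \<in> P"
      using insert.prems(1) True by auto
    ultimately show ?thesis
      using P vk by (auto simp: submodule_iff)
  qed
qed

section \<open>The universal property of the standard basis\<close>

lemma finsum_smult:
  assumes "finite A" and "a \<in> carrier R" and "f \<in> A \<rightarrow> carrier M"
  shows "a \<odot>\<^bsub>M\<^esub> finsum M f A = finsum M (\<lambda>i. a \<odot>\<^bsub>M\<^esub> f i) A"
  using assms
  by (induction A rule: finite_induct)
     (auto simp: smult_r_null smult_r_distr smult_closed Pi_iff)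

text \<open>The map sends \<open>v\<close> to the sum of the \<open>v i\<close> times
  \<open>m i\<close>. This is the existence half of freeness; uniqueness comes from
  \<open>submodule_equalizer\<close> and \<open>hom_image_supported\<close>.\<close>

lemma ex_hom_std_vec:
  assumes m: "\<And>i. i < n \<Longrightarrow> m i \<in> carrier M"
  shows "\<exists>h\<in>mod_hom R (left_pow R n) M. \<forall>i<n. h (std_vec R n i) = m i"
proof
  let ?h = "\<lambda>v. finsum M (\<lambda>i. v i \<odot>\<^bsub>M\<^esub> m i) {..<n}"
  have cl: "(\<lambda>i. v i \<odot>\<^bsub>M\<^esub> m i) \<in> {..<n} \<rightarrow> carrier M" if "v \<in> carrier (left_pow R n)" for v
    using that m by (auto simp: left_pow_simps PiE_iff intro!: smult_closed)
  show "?h \<in> mod_hom R (left_pow R n) M"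
    unfolding mod_hom_def
  proof (intro CollectI conjI ballI funcsetI)
    fix v assume "v \<in> carrier (left_pow R n)"
    then show "?h v \<in> carrier M"
      by (intro M.finsum_closed cl)
  next
    fix v w assume v: "v \<in> carrier (left_pow R n)" and w: "w \<in> carrier (left_pow R n)"
    have "?h v \<oplus>\<^bsub>M\<^esub> ?h w = finsum M (\<lambda>i. v i \<odot>\<^bsub>M\<^esub> m i \<oplus>\<^bsub>M\<^esub> w i \<odot>\<^bsub>M\<^esub> m i) {..<n}"
      using v w by (intro M.finsum_addf[symmetric] cl)
    also have "\<dots> = ?h (v \<oplus>\<^bsub>left_pow R n\<^esub> w)"
      using v w m by (intro M.finsum_cong')
        (auto simp: left_pow_simps PiE_iff smult_l_distr intro!: smult_closed)
    finally show "?h (v \<oplus>\<^bsub>left_pow R n\<^esub> w) = ?h v \<oplus>\<^bsub>M\<^esub> ?h w" ..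
  next
    fix a v assume a: "a \<in> carrier R" and v: "v \<in> carrier (left_pow R n)"
    have "a \<odot>\<^bsub>M\<^esub> ?h v = finsum M (\<lambda>i. a \<odot>\<^bsub>M\<^esub> (v i \<odot>\<^bsub>M\<^esub> m i)) {..<n}"
      using a cl[OF v] by (intro finsum_smult) auto
    also have "\<dots> = ?h (a \<odot>\<^bsub>left_pow R n\<^esub> v)"
      using a v m by (intro M.finsum_cong')
        (auto simp: left_pow_simps PiE_iff smult_assoc intro!: smult_closed)
    finally show "?h (a \<odot>\<^bsub>left_pow R n\<^esub> v) = a \<odot>\<^bsub>M\<^esub> ?h v" ..
  qed
  show "\<forall>i<n. ?h (std_vec R n i) = m i"
  proof (intro allI impI)
    fix k assume k: "k < n"
    have "?h (std_vec R n k) = finsum M (\<lambda>i. if k = i then m i else \<zero>\<^bsub>M\<^esub>) {..<n}"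
      using m by (intro M.finsum_cong') (auto simp: std_vec_def smult_one smult_l_null)
    also have "\<dots> = m k"
      using k m by (intro M.finsum_singleton) auto
    finally show "?h (std_vec R n k) = m k" .
  qed
qed

end

section \<open>Direct summands\<close>

locale direct_decomposition = left_module +
  fixes P Q
  assumes P: "submodule P R M" and Q: "submodule Q R M"
    and disjoint: "P \<inter> Q = {\<zero>\<^bsub>M\<^esub>}" and sum: "P <+>\<^bsub>M\<^esub> Q = carrier M"
begin

lemma decompose:
  assumes "x \<in> carrier M"
  obtains p q where "p \<in> P" and "q \<in> Q" and "x = p \<oplus>\<^bsub>M\<^esub> q"
  using assms that unfolding sum[symmetric] by (auto simp: set_add_def set_mult_def)

text \<open>The difference p - p' = q' - q lies in both summands, so it vanishes.\<close>

lemma decompose_unique: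
  assumes "p \<in> P" "q \<in> Q" "p' \<in> P" "q' \<in> Q" and eq: "p \<oplus>\<^bsub>M\<^esub> q = p' \<oplus>\<^bsub>M\<^esub> q'"
  shows "p = p'" and "q = q'"
proof -
  have cl: "p \<in> carrier M" "q \<in> carrier M" "p' \<in> carrier M" "q' \<in> carrier M"
    using assms(1-4) P Q by (auto simp: submodule_iff)
  have "(\<ominus>\<^bsub>M\<^esub> p' \<oplus>\<^bsub>M\<^esub> p) \<oplus>\<^bsub>M\<^esub> q = \<ominus>\<^bsub>M\<^esub> p' \<oplus>\<^bsub>M\<^esub> (p' \<oplus>\<^bsub>M\<^esub> q')"
    using cl by (simp add: M.a_assoc eq)
  then have "(\<ominus>\<^bsub>M\<^esub> p' \<oplus>\<^bsub>M\<^esub> p) \<oplus>\<^bsub>M\<^esub> q = q'"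
    using cl by (simp add: M.r_neg1)
  then have "\<ominus>\<^bsub>M\<^esub> p' \<oplus>\<^bsub>M\<^esub> p = q' \<oplus>\<^bsub>M\<^esub> \<ominus>\<^bsub>M\<^esub> q"
    using cl by (metis M.a_inv_closed M.add.inv_solve_right M.a_closed a_inv_def)
  moreover have "\<ominus>\<^bsub>M\<^esub> p' \<oplus>\<^bsub>M\<^esub> p \<in> P"
    using assms P submodule_minus[OF P] by (auto simp: submodule_iff)
  moreover have "q' \<oplus>\<^bsub>M\<^esub> \<ominus>\<^bsub>M\<^esub> q \<in> Q"
    using assms Q submodule_minus[OF Q] by (auto simp: submodule_iff)
  ultimately have "\<ominus>\<^bsub>M\<^esub> p' \<oplus>\<^bsub>M\<^esub> p = \<zero>\<^bsub>M\<^esub>"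
    using disjoint by auto
  then show "p = p'"
    using cl by (metis M.a_inv_closed M.minus_equality M.minus_minus M.a_comm)
  then show "q = q'"
    using eq cl by simp
qed

text \<open>A first component is chosen for each vector, and uniqueness of decompositions makes the
  choice linear. The target has carrier \<open>P\<close>, so that the projection composes with maps
  defined only there.\<close>

lemma ex_projection:
  "\<exists>\<pi>\<in>mod_hom R M (M\<lparr>carrier := P\<rparr>). \<forall>x\<in>P. \<pi> x = x"
proof -
  have "\<forall>x\<in>carrier M. \<exists>p. p \<in> P \<and> (\<exists>q\<in>Q. x = p \<oplus>\<^bsub>M\<^esub> q)"
    by (metis decompose)
  then obtain \<pi> where \<pi>: "\<And>x. x \<in> carrier M \<Longrightarrow> \<pi> x \<in> P \<and> (\<exists>q\<in>Q. x = \<pi> x \<oplus>\<^bsub>M\<^esub> q)"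
    by metis
  have cl: "P \<subseteq> carrier M" "Q \<subseteq> carrier M"
    using P Q by (auto simp: submodule_iff)
  \<comment> \<open>Whatever decomposition of \<open>x\<close> is found, its first component is
    \<open>\<pi> x\<close>. Below it is fed with sums and scalar multiples of known
    decompositions.\<close>
  have eqI: "\<pi> x = p" if "x \<in> carrier M" "p \<in> P" "q \<in> Q" "x = p \<oplus>\<^bsub>M\<^esub> q" for x p q
    using \<pi>[OF that(1)] that decompose_unique(1) by metis
  show ?thesis
  proof (intro bexI ballI)
    fix x assume "x \<in> P"
    then show "\<pi> x = x"
      using cl Q by (intro eqI[of _ _ "\<zero>\<^bsub>M\<^esub>"]) (auto simp: submodule_iff)
  next
    show "\<pi> \<in> mod_hom R M (M\<lparr>carrier := P\<rparr>)"
      unfolding mod_hom_def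
    proof (intro CollectI conjI ballI funcsetI)
      fix x assume "x \<in> carrier M"
      then show "\<pi> x \<in> carrier (M\<lparr>carrier := P\<rparr>)"
        using \<pi> by simp
    next
      fix x y assume x: "x \<in> carrier M" and y: "y \<in> carrier M"
      obtain q q' where q: "q \<in> Q" "x = \<pi> x \<oplus>\<^bsub>M\<^esub> q" "q' \<in> Q" "y = \<pi> y \<oplus>\<^bsub>M\<^esub> q'"
        using \<pi>[OF x] \<pi>[OF y] by auto
      have "(\<pi> x \<oplus>\<^bsub>M\<^esub> q) \<oplus>\<^bsub>M\<^esub> (\<pi> y \<oplus>\<^bsub>M\<^esub> q') = (\<pi> x \<oplus>\<^bsub>M\<^esub> \<pi> y) \<oplus>\<^bsub>M\<^esub> (q \<oplus>\<^bsub>M\<^esub> q')"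
        using \<pi>[OF x] \<pi>[OF y] q(1,3) cl by (simp add: M.a_ac subset_iff)
      then have "x \<oplus>\<^bsub>M\<^esub> y = (\<pi> x \<oplus>\<^bsub>M\<^esub> \<pi> y) \<oplus>\<^bsub>M\<^esub> (q \<oplus>\<^bsub>M\<^esub> q')"
        using q(2,4) by simp
      then have "\<pi> (x \<oplus>\<^bsub>M\<^esub> y) = \<pi> x \<oplus>\<^bsub>M\<^esub> \<pi> y"
        using x y q(1,3) \<pi>[OF x] \<pi>[OF y] P Q
        by (intro eqI[of _ _ "q \<oplus>\<^bsub>M\<^esub> q'"]) (auto simp: submodule_iff)
      then show "\<pi> (x \<oplus>\<^bsub>M\<^esub> y) = \<pi> x \<oplus>\<^bsub>M\<lparr>carrier := P\<rparr>\<^esub> \<pi> y"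
        by simp
    next
      fix a x assume a: "a \<in> carrier R" and x: "x \<in> carrier M"
      obtain q where q: "q \<in> Q" "x = \<pi> x \<oplus>\<^bsub>M\<^esub> q"
        using \<pi>[OF x] by auto
      have "a \<odot>\<^bsub>M\<^esub> (\<pi> x \<oplus>\<^bsub>M\<^esub> q) = a \<odot>\<^bsub>M\<^esub> \<pi> x \<oplus>\<^bsub>M\<^esub> a \<odot>\<^bsub>M\<^esub> q"
        using a \<pi>[OF x] q(1) cl by (intro smult_r_distr) auto
      then have "a \<odot>\<^bsub>M\<^esub> x = a \<odot>\<^bsub>M\<^esub> \<pi> x \<oplus>\<^bsub>M\<^esub> a \<odot>\<^bsub>M\<^esub> q"
        using q(2) by simp
      then have "\<pi> (a \<odot>\<^bsub>M\<^esub> x) = a \<odot>\<^bsub>M\<^esub> \<pi> x"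
        using a q(1) \<pi>[OF x] P Q
        by (intro eqI[OF smult_closed[OF a x], of _ "a \<odot>\<^bsub>M\<^esub> q"]) (auto simp: submodule_iff)
      then show "\<pi> (a \<odot>\<^bsub>M\<^esub> x) = a \<odot>\<^bsub>M\<lparr>carrier := P\<rparr>\<^esub> \<pi> x"
        by simp
    qed
  qed
qed

end

text \<open>A retract of a free module is projective: \<open>f \<circ> \<pi>\<close> is lifted along
  \<open>g\<close> on the standard basis, and the lift is restricted to \<open>P\<close>, where
  \<open>\<pi>\<close> is the identity.\<close>

lemma left_projective_summand:
  assumes "direct_decomposition R (left_pow R n) P Q"
  shows "left_projective TYPE('m) TYPE('k) R ((left_pow R n)\<lparr>carrier := P\<rparr>)"
proof -
  interpret direct_decomposition R "left_pow R n" P Q by fact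
  obtain \<pi> where \<pi>: "\<pi> \<in> mod_hom R (left_pow R n) ((left_pow R n)\<lparr>carrier := P\<rparr>)"
      "\<And>x. x \<in> P \<Longrightarrow> \<pi> x = x"
    using ex_projection by blast
  have P_sub: "P \<subseteq> carrier (left_pow R n)"
    using P by (simp add: submodule_iff)
  have "\<exists>h\<in>mod_hom R ((left_pow R n)\<lparr>carrier := P\<rparr>) M. \<forall>x\<in>P. g (h x) = f x"
    if M: "left_module R M" and N: "left_module R N" and g: "g \<in> mod_hom R M N"
      and surj: "g ` carrier M = carrier N"
      and f: "f \<in> mod_hom R ((left_pow R n)\<lparr>carrier := P\<rparr>) N"
    for M :: "(_, 'm) module" and N :: "(_, 'k) module" and g f
  proof -
    interpret N: left_module R N by fact
    have f\<pi>: "f \<circ> \<pi> \<in> mod_hom R (left_pow R n) N"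
      using \<pi>(1) f by (rule mod_hom_compose)
    \<comment> \<open>Surjectivity of \<open>g\<close> supplies the prescribed images of the basis
      vectors; for \<open>i \<ge> n\<close> the vector is zero, so no bound on \<open>i\<close> is
      imposed.\<close>
    have "\<exists>m. m \<in> carrier M \<and> g m = (f \<circ> \<pi>) (std_vec R n i)" for i
    proof -
      have "(f \<circ> \<pi>) (std_vec R n i) \<in> g ` carrier M"
        unfolding surj by (rule mod_homD(1)[OF f\<pi> R.std_vec_closed])
      then show ?thesis by (auto simp: image_iff)
    qed
    then obtain m where m: "\<And>i. m i \<in> carrier M" "\<And>i. g (m i) = (f \<circ> \<pi>) (std_vec R n i)"
      by metis
    obtain h where h: "h \<in> mod_hom R (left_pow R n) M" "\<And>i. i < n \<Longrightarrow> h (std_vec R n i) = m i"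
      using left_module.ex_hom_std_vec[OF M, of n m] m(1) by blast
    have gh: "g \<circ> h \<in> mod_hom R (left_pow R n) N"
      using h(1) g by (rule mod_hom_compose)
    \<comment> \<open>The two composites agree on every standard vector, so their equalizer is the
      whole module.\<close>
    let ?E = "{x \<in> carrier (left_pow R n). (g \<circ> h) x = (f \<circ> \<pi>) x}"
    have "id v \<in> ?E" if "v \<in> carrier (left_pow R n)" for v
    proof (rule hom_image_supported[where S = "{..<n}" and h = id and n = n])
      show "submodule ?E R (left_pow R n)"
        by (rule submodule_equalizer) (fact left_module_axioms N gh f\<pi>)+
      show "id \<in> mod_hom R (left_pow R n) (left_pow R n)"
        by (simp add: mod_hom_def)
      show "id (std_vec R n i) \<in> ?E" if "i \<in> {..<n}" "i < n" for i
        using that h(2) m(2) by (simp add: R.std_vec_closed)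
    qed (use that in simp_all)
    then have "\<forall>x\<in>P. g (h x) = f x"
      using P_sub \<pi>(2) by (simp add: subset_iff)
    moreover have "h \<in> mod_hom R ((left_pow R n)\<lparr>carrier := P\<rparr>) M"
      using h(1) P_sub by (auto simp: mod_hom_def subset_iff)
    ultimately show ?thesis by blast
  qed
  then show ?thesis
    unfolding left_projective_def
    by (intro conjI allI impI left_module_submodule[OF P]) simp
qed

section \<open>Summands over local rings\<close>

text \<open>The linear map that sends the \<open>k\<close>-th standard vector to \<open>u\<close>
  and fixes the others. On row vectors it is right multiplication by the identity matrix with row
  \<open>k\<close> replaced by \<open>u\<close>, which is why the entries of \<open>u\<close> stand
  on the right.\<close>

definition exchange :: "('a, 'r) ring_scheme \<Rightarrow> nat \<Rightarrow> nat \<Rightarrow> (nat \<Rightarrow> 'a) \<Rightarrow> (nat \<Rightarrow> 'a) \<Rightarrow> nat \<Rightarrow> 'a"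
  where
  "exchange R n k u v =
     (\<lambda>i\<in>{..<n}. if i = k then v k \<otimes>\<^bsub>R\<^esub> u k else v i \<oplus>\<^bsub>R\<^esub> v k \<otimes>\<^bsub>R\<^esub> u i)"

context ring
begin

lemma exchange_hom:
  assumes "u \<in> carrier (left_pow R n)" and "k < n"
  shows "exchange R n k u \<in> mod_hom R (left_pow R n) (left_pow R n)"
proof -
  have cl: "v i \<in> carrier R" if "v \<in> carrier (left_pow R n)" "i < n" for v i
    using that by (auto simp: left_pow_simps)
  show ?thesis
    unfolding mod_hom_def
  proof (intro CollectI conjI ballI funcsetI)
    fix v assume v: "v \<in> carrier (left_pow R n)"
    show "exchange R n k u v \<in> carrier (left_pow R n)"
      using cl[OF v] cl[OF assms(1)] assms(2) by (simp add: exchange_def left_pow_simps)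
  next
    fix v w assume v: "v \<in> carrier (left_pow R n)" and w: "w \<in> carrier (left_pow R n)"
    have "(v i \<oplus> w i) \<oplus> (v k \<oplus> w k) \<otimes> u i = (v i \<oplus> v k \<otimes> u i) \<oplus> (w i \<oplus> w k \<otimes> u i)"
      if "i < n" for i
      using that assms(2) cl[OF v] cl[OF w] cl[OF assms(1)] by (simp add: l_distr a_ac)
    then show "exchange R n k u (v \<oplus>\<^bsub>left_pow R n\<^esub> w) =
        exchange R n k u v \<oplus>\<^bsub>left_pow R n\<^esub> exchange R n k u w"
      using assms(2) cl[OF v] cl[OF w] cl[OF assms(1)]
      by (intro ext) (simp add: left_pow_simps exchange_def l_distr)
  next
    fix a v assume a: "a \<in> carrier R" and v: "v \<in> carrier (left_pow R n)"
    show "exchange R n k u (a \<odot>\<^bsub>left_pow R n\<^esub> v) =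
        a \<odot>\<^bsub>left_pow R n\<^esub> exchange R n k u v"
      using assms(2) a cl[OF v] cl[OF assms(1)]
      by (intro ext) (simp add: left_pow_simps exchange_def r_distr m_assoc)
  qed
qed

lemma exchange_std_vec:
  assumes u: "u \<in> carrier (left_pow R n)" and k: "k < n"
  shows "exchange R n k u (std_vec R n k) = u"
    and "i < n \<Longrightarrow> i \<noteq> k \<Longrightarrow> exchange R n k u (std_vec R n i) = std_vec R n i"
proof -
  have cl: "u j \<in> carrier R" if "j < n" for j
    using that u by (auto simp: left_pow_simps)
  show "exchange R n k u (std_vec R n k) = u"
  proof
    show "exchange R n k u (std_vec R n k) j = u j" for j
      using cl k PiE_arb[OF u[unfolded left_pow_simps], of j]
      by (cases "j < n") (simp_all add: exchange_def std_vec_def)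
  qed
  show "exchange R n k u (std_vec R n i) = std_vec R n i" if "i < n" "i \<noteq> k"
    using cl k that by (intro ext) (simp add: exchange_def std_vec_def)
qed

text \<open>The image \<open>w\<close> determines the coefficient of \<open>u\<close> as
  \<open>w k \<otimes> inv (u k)\<close>; subtracting that multiple of \<open>u\<close> recovers the
  other coordinates. The map \<open>?inv\<close> is this elimination with pivot
  \<open>u k\<close>.\<close>

lemma exchange_bij:
  assumes u: "u \<in> carrier (left_pow R n)" and k: "k < n" and unit: "u k \<in> Units R"
  shows "bij_betw (exchange R n k u) (carrier (left_pow R n)) (carrier (left_pow R n))"
proof (rule bij_betw_byWitness)
  let ?inv = "\<lambda>w. \<lambda>i\<in>{..<n}. if i = k then w k \<otimes> inv (u k)
                              else w i \<ominus> (w k \<otimes> inv (u k)) \<otimes> u i"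
  have cl: "v i \<in> carrier R" if "v \<in> carrier (left_pow R n)" "i < n" for v i
    using that by (auto simp: left_pow_simps)
  have ivc: "inv (u k) \<in> carrier R"
    using unit by simp
  have inv_cancel: "(x \<otimes> u k) \<otimes> inv (u k) = x" "(x \<otimes> inv (u k)) \<otimes> u k = x"
    if "x \<in> carrier R" for x
    using that cl[OF u k] ivc unit by (simp_all add: m_assoc)
  have add_cancel: "(x \<oplus> y) \<ominus> y = x" "(x \<ominus> y) \<oplus> y = x"
    if "x \<in> carrier R" "y \<in> carrier R" for x y
    using that by (simp_all add: minus_eq a_assoc r_neg l_neg)
  show "\<forall>v\<in>carrier (left_pow R n). ?inv (exchange R n k u v) = v"
  proof (intro ballI ext)
    fix v i assume v: "v \<in> carrier (left_pow R n)"
    show "?inv (exchange R n k u v) i = v i"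
      using k cl[OF v] cl[OF u] PiE_arb[OF v[unfolded left_pow_simps], of i]
      by (cases "i < n") (simp_all add: exchange_def inv_cancel add_cancel)
  qed
  show "\<forall>w\<in>carrier (left_pow R n). exchange R n k u (?inv w) = w"
  proof (intro ballI ext)
    fix w i assume w: "w \<in> carrier (left_pow R n)"
    show "exchange R n k u (?inv w) i = w i"
      using k cl[OF w] cl[OF u] ivc PiE_arb[OF w[unfolded left_pow_simps], of i]
      by (cases "i < n") (simp_all add: exchange_def inv_cancel add_cancel)
  qed
  show "exchange R n k u ` carrier (left_pow R n) \<subseteq> carrier (left_pow R n)"
    using mod_homD(1)[OF exchange_hom[OF u k]] by auto
  show "?inv ` carrier (left_pow R n) \<subseteq> carrier (left_pow R n)"
    using cl cl[OF u] ivc k by (intro image_subsetI) (simp add: left_pow_simps)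
qed

section \<open>Left ideals and units of a local ring\<close>

lemma left_ideal_principal:
  assumes "a \<in> carrier R"
  shows "left_ideal ((\<lambda>x. x \<otimes> a) ` carrier R) R"
proof -
  have "subgroup ((\<lambda>x. x \<otimes> a) ` carrier R) (add_monoid R)"
  proof (rule group.subgroupI[OF add.group_axioms])
    fix x y
    assume "x \<in> (\<lambda>x. x \<otimes> a) ` carrier R" "y \<in> (\<lambda>x. x \<otimes> a) ` carrier R"
    then show "x \<otimes>\<^bsub>add_monoid R\<^esub> y \<in> (\<lambda>x. x \<otimes> a) ` carrier R"
      using assms by (auto simp: l_distr[symmetric])
  next
    fix x assume "x \<in> (\<lambda>x. x \<otimes> a) ` carrier R"
    then obtain y where "y \<in> carrier R" "x = y \<otimes> a" by auto
    then have "\<ominus> x = (\<ominus> y) \<otimes> a" "\<ominus> y \<in> carrier R"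
      using assms by (auto simp: l_minus)
    then show "inv\<^bsub>add_monoid R\<^esub> x \<in> (\<lambda>x. x \<otimes> a) ` carrier R"
      by (auto simp: a_inv_def)
  qed (use assms in auto)
  then show ?thesis
    using assms by (auto simp: left_ideal_def additive_subgroup_def m_assoc[symmetric])
qed

lemma left_ideal_with_one:
  assumes "left_ideal I R" and "\<one> \<in> I"
  shows "I = carrier R"
  using assms additive_subgroup.a_subset[of I R] r_one unfolding left_ideal_def by force

text \<open>Two elements of the union lie in two ideals of the chain, and the larger of these
  contains their sum.\<close>

lemma left_ideal_Union_chain:
  assumes "\<C> \<noteq> {}" and chain: "subset.chain A \<C>" and ideal: "\<And>I. I \<in> \<C> \<Longrightarrow> left_ideal I R"
  shows "left_ideal (\<Union>\<C>) R"
proof -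
  have sg: "additive_subgroup I R" if "I \<in> \<C>" for I
    using ideal[OF that] by (simp add: left_ideal_def)
  have "subgroup (\<Union>\<C>) (add_monoid R)"
  proof (rule group.subgroupI[OF add.group_axioms])
    show "\<Union>\<C> \<subseteq> carrier (add_monoid R)"
      using additive_subgroup.a_subset[OF sg] by auto
    show "\<Union>\<C> \<noteq> {}"
      using assms(1) additive_subgroup.zero_closed[OF sg] by blast
    fix x assume "x \<in> \<Union>\<C>"
    then show "inv\<^bsub>add_monoid R\<^esub> x \<in> \<Union>\<C>"
      using additive_subgroup.a_inv_closed[OF sg] by (auto simp: a_inv_def)
  next
    fix x y assume "x \<in> \<Union>\<C>" "y \<in> \<Union>\<C>"
    then obtain I J where IJ: "I \<in> \<C>" "J \<in> \<C>" "x \<in> I" "y \<in> J"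
      by auto
    then have "I \<subseteq> J \<or> J \<subseteq> I"
      using chain by (auto simp: subset.chain_def)
    then show "x \<otimes>\<^bsub>add_monoid R\<^esub> y \<in> \<Union>\<C>"
    proof
      assume "I \<subseteq> J"
      then show ?thesis
        using IJ additive_subgroup.a_closed[OF sg[OF IJ(2)], of x y] by auto
    next
      assume "J \<subseteq> I"
      then show ?thesis
        using IJ additive_subgroup.a_closed[OF sg[OF IJ(1)], of x y] by auto
    qed
  qed
  then show ?thesis
    using ideal by (auto simp: left_ideal_def additive_subgroup_def)
qed

text \<open>Zorn's lemma, with properness expressed as \<open>\<one> \<notin> I\<close>, a condition
  that passes to unions.\<close>

lemma ex_maximal_left_ideal:
  assumes J: "left_ideal J R" "J \<noteq> carrier R"
  obtains I where "maximal_left_ideal I R" and "J \<subseteq> I"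
proof -
  let ?A = "{I. left_ideal I R \<and> J \<subseteq> I \<and> \<one> \<notin> I}"
  have "J \<in> ?A"
    using J left_ideal_with_one by auto
  moreover have "\<Union>\<C> \<in> ?A" if "\<C> \<noteq> {}" "subset.chain ?A \<C>" for \<C>
  proof -
    have "\<C> \<subseteq> ?A"
      using that(2) by (auto simp: subset.chain_def)
    then show ?thesis
      using left_ideal_Union_chain[OF that] that(1) by blast
  qed
  ultimately obtain I where I: "I \<in> ?A" "\<forall>K\<in>?A. I \<subseteq> K \<longrightarrow> K = I"
    using subset_Zorn_nonempty[of ?A] by blast
  have "maximal_left_ideal I R"
    unfolding maximal_left_ideal_def
  proof (intro conjI allI impI)
    show "left_ideal I R" "I \<noteq> carrier R"
      using I(1) by auto
    show "K = I \<or> K = carrier R" if "left_ideal K R" "I \<subseteq> K" for K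
      using I that left_ideal_with_one[OF that(1)] by blast
  qed
  then show ?thesis
    using that I(1) by auto
qed

text \<open>Every element outside the unique maximal left ideal \<open>I\<close> is a unit, and two
  elements of \<open>I\<close> cannot add up to \<open>\<one>\<close>.\<close>

lemma local_ring_unit_sum:
  assumes "local_ring R" and "a \<in> carrier R" "b \<in> carrier R" and "a \<oplus> b = \<one>"
  shows "a \<in> Units R \<or> b \<in> Units R"
proof -
  obtain I where I: "maximal_left_ideal I R" and unique: "\<And>J. maximal_left_ideal J R \<Longrightarrow> J = I"
    using assms(1) by (auto simp: local_ring_def)
  have lid: "left_ideal I R" and "I \<noteq> carrier R"
    using I by (auto simp: maximal_left_ideal_def)
  interpret additive_subgroup I R
    using lid by (simp add: left_ideal_def)
  have mult: "x \<otimes> y \<in> I" if "x \<in> carrier R" "y \<in> I" for x y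
    using lid that by (simp add: left_ideal_def)
  have one: "\<one> \<notin> I"
    using lid \<open>I \<noteq> carrier R\<close> left_ideal_with_one by auto
  \<comment> \<open>Without a left inverse, the left ideal generated by \<open>x\<close> is proper
    and sits in a maximal one. That can only be \<open>I\<close>, yet it contains
    \<open>x\<close>.\<close>
  have left_inverse: "\<exists>y\<in>carrier R. y \<otimes> x = \<one>" if x: "x \<in> carrier R" "x \<notin> I" for x
  proof (rule ccontr)
    assume "\<not> ?thesis"
    then have "(\<lambda>y. y \<otimes> x) ` carrier R \<noteq> carrier R"
      by (metis (no_types, lifting) imageE one_closed)
    then obtain J where J: "maximal_left_ideal J R" "(\<lambda>y. y \<otimes> x) ` carrier R \<subseteq> J"
      using ex_maximal_left_ideal left_ideal_principal[OF x(1)] by blast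
    have "\<one> \<otimes> x \<in> J"
      using J(2) by blast
    then show False
      using unique[OF J(1)] x by simp
  qed
  have unit: "x \<in> Units R" if x: "x \<in> carrier R" "x \<notin> I" for x
  proof -
    obtain y where y: "y \<in> carrier R" "y \<otimes> x = \<one>"
      using left_inverse[OF x] by auto
    \<comment> \<open>If y were in \<open>I\<close>, so would be xy, and 1 - xy would have a left
      inverse \<open>c\<close>. But (1 - xy)x = x - x(yx) = 0, so x = 0, which lies in
      \<open>I\<close>.\<close>
    have "y \<notin> I"
    proof
      assume "y \<in> I"
      then have "x \<otimes> y \<in> I"
        using mult x(1) by simp
      moreover have "x \<otimes> y \<oplus> (\<one> \<ominus> x \<otimes> y) = \<one>"
        using x(1) y(1) by (simp add: minus_eq a_lcomm r_neg)
      ultimately have "\<one> \<ominus> x \<otimes> y \<notin> I"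
        using one a_closed by metis
      then obtain c where c: "c \<in> carrier R" "c \<otimes> (\<one> \<ominus> x \<otimes> y) = \<one>"
        using left_inverse[of "\<one> \<ominus> x \<otimes> y"] x(1) y(1) by auto
      have "(\<one> \<ominus> x \<otimes> y) \<otimes> x = \<zero>"
        using x(1) y by (simp add: minus_eq l_distr l_minus m_assoc r_neg)
      then have "(c \<otimes> (\<one> \<ominus> x \<otimes> y)) \<otimes> x = \<zero>"
        using c(1) x(1) y(1) by (simp add: m_assoc)
      then show False
        using c(2) x zero_closed by simp
    qed
    \<comment> \<open>A left inverse of \<open>y\<close> coincides with its right inverse
      \<open>x\<close>, so \<open>y\<close> is a two-sided inverse of \<open>x\<close>.\<close>
    then obtain z where z: "z \<in> carrier R" "z \<otimes> y = \<one>"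
      using left_inverse y(1) by auto
    have "z = z \<otimes> (y \<otimes> x)"
      using y z by simp
    also have "\<dots> = x"
      using x(1) y(1) z by (simp add: m_assoc[symmetric])
    finally show ?thesis
      using x(1) y z by (auto simp: Units_def)
  qed
  have "a \<notin> I \<or> b \<notin> I"
    using a_closed[of a b] assms(4) one by auto
  then show ?thesis
    using unit assms(2,3) by auto
qed

end

section \<open>Bases adapted to a direct decomposition\<close>

context direct_decomposition
begin

text \<open>Induction on the number \<open>k\<close> of basis vectors already moved into
  \<open>P\<close> or \<open>Q\<close>. Locality enters through \<open>unit_sum\<close>, a condition
  that passes to the opposite ring.\<close>

lemma adapted_basis:
  assumes unit_sum: "\<And>a b. a \<in> carrier R \<Longrightarrow> b \<in> carrier R \<Longrightarrow> a \<oplus>\<^bsub>R\<^esub> b = \<one>\<^bsub>R\<^esub>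
      \<Longrightarrow> a \<in> Units R \<or> b \<in> Units R"
    and h: "h \<in> mod_hom R (left_pow R n) M" "bij_betw h (carrier (left_pow R n)) (carrier M)"
    and "k \<le> n"
  shows "\<exists>h. h \<in> mod_hom R (left_pow R n) M \<and> bij_betw h (carrier (left_pow R n)) (carrier M) \<and>
           (\<forall>i<k. h (std_vec R n i) \<in> P \<union> Q)"
  using \<open>k \<le> n\<close>
proof (induction k)
  case 0
  then show ?case
    using h by auto
next
  case (Suc k)
  let ?F = "left_pow R n"
  obtain g where g: "g \<in> mod_hom R ?F M" "bij_betw g (carrier ?F) (carrier M)"
      "\<And>i. i < k \<Longrightarrow> g (std_vec R n i) \<in> P \<union> Q"
    using Suc by auto
  have k: "k < n"
    using Suc.prems by simp
  obtain p q where pq: "p \<in> P" "q \<in> Q" "g (std_vec R n k) = p \<oplus>\<^bsub>M\<^esub> q"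
    using decompose mod_homD(1)[OF g(1) R.std_vec_closed] by metis
  have "p \<in> g ` carrier ?F" "q \<in> g ` carrier ?F"
    using pq(1,2) P Q bij_betw_imp_surj_on[OF g(2)] by (auto simp: submodule_iff)
  \<comment> \<open>These are the coordinates of \<open>p\<close> and \<open>q\<close> in the
    current basis. Injectivity of \<open>g\<close> makes their sum the \<open>k\<close>-th standard
    vector, whose entry at \<open>k\<close> is 1.\<close>
  then obtain u w where u: "u \<in> carrier ?F" "g u = p" and w: "w \<in> carrier ?F" "g w = q"
    by auto
  have "u \<oplus>\<^bsub>?F\<^esub> w \<in> carrier ?F"
    using u(1) w(1) by (auto simp: left_pow_simps)
  moreover have "g (u \<oplus>\<^bsub>?F\<^esub> w) = g (std_vec R n k)"
    using u w pq(3) by (simp add: mod_homD[OF g(1)])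
  ultimately have "u \<oplus>\<^bsub>?F\<^esub> w = std_vec R n k"
    using bij_betw_imp_inj_on[OF g(2)] R.std_vec_closed by (meson inj_onD)
  then have "u k \<oplus>\<^bsub>R\<^esub> w k = \<one>\<^bsub>R\<^esub>"
    using k by (auto simp: left_pow_simps std_vec_def dest: fun_cong[of _ _ k])
  then have "u k \<in> Units R \<or> w k \<in> Units R"
    using u(1) w(1) k by (intro unit_sum) (auto simp: left_pow_simps)
  \<comment> \<open>\<open>x\<close> is whichever of \<open>u\<close> and \<open>w\<close> has an
    invertible entry at \<open>k\<close>. Precomposing with its exchange map puts \<open>g x\<close>
    at position \<open>k\<close> and keeps the earlier vectors.\<close>
  then obtain x where x: "x \<in> carrier ?F" "g x \<in> P \<union> Q" "x k \<in> Units R"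
    using u w pq by auto
  have "g \<circ> exchange R n k x \<in> mod_hom R ?F M"
    using R.exchange_hom[OF x(1) k] g(1) by (rule mod_hom_compose)
  moreover have "bij_betw (g \<circ> exchange R n k x) (carrier ?F) (carrier M)"
    using R.exchange_bij[OF x(1) k x(3)] g(2) by (rule bij_betw_trans)
  moreover have "(g \<circ> exchange R n k x) (std_vec R n i) \<in> P \<union> Q" if "i < Suc k" for i
    using that g(3)[of i] x(2) k R.exchange_std_vec(2)[OF x(1) k, of i] R.exchange_std_vec(1)[OF x(1) k]
    by (cases "i = k") auto
  ultimately show ?case
    by blast
qed

text \<open>The basis vectors in \<open>P\<close> span \<open>P\<close>: the expansion of an element
  of \<open>P\<close> splits into a part from \<open>P\<close> and a part from \<open>Q\<close>, and
  uniqueness of decompositions identifies the element with the former.\<close>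

lemma left_free_adapted:
  assumes h: "h \<in> mod_hom R (left_pow R n) M" "bij_betw h (carrier (left_pow R n)) (carrier M)"
    and adapted: "\<And>i. i < n \<Longrightarrow> h (std_vec R n i) \<in> P \<union> Q"
  shows "left_free R (M\<lparr>carrier := P\<rparr>)"
proof -
  \<comment> \<open>By \<open>adapted\<close>, the vectors at the indices outside \<open>S\<close>
    lie in \<open>Q\<close>.\<close>
  define S where "S = {i. i < n \<and> h (std_vec R n i) \<in> P}"
  have "finite S"
    by (simp add: S_def)
  define s where "s = card S"
  obtain \<sigma> where \<sigma>: "bij_betw \<sigma> {..<s} S"
    using ex_bij_betw_nat_finite[OF \<open>finite S\<close>] by (auto simp: s_def lessThan_atLeast0)
  define \<tau> where "\<tau> = inv_into {..<s} \<sigma>"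
  have \<tau>: "\<tau> i < s" "\<sigma> (\<tau> i) = i" if "i \<in> S" for i
    using that bij_betw_inv_into_right[OF \<sigma>] bij_betwE[OF bij_betw_inv_into[OF \<sigma>]]
    by (auto simp: \<tau>_def)
  have \<sigma>': "\<sigma> j \<in> S" "\<sigma> j < n" "\<tau> (\<sigma> j) = j" if "j < s" for j
    using that bij_betw_inv_into_left[OF \<sigma>] bij_betwE[OF \<sigma>] by (auto simp: \<tau>_def S_def)
  \<comment> \<open>The embedding of R^s into R^n as the vectors supported on \<open>S\<close>:
    coordinates are renumbered along \<open>\<sigma>\<close>, and the other positions are filled
    with zeros.\<close>
  define \<iota> where "\<iota> w = (\<lambda>i\<in>{..<n}. if i \<in> S then w (\<tau> i) else \<zero>\<^bsub>R\<^esub>)" for w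
  have \<iota>: "\<iota> \<in> mod_hom R (left_pow R s) (left_pow R n)"
    unfolding mod_hom_def
  proof (intro CollectI conjI ballI funcsetI)
    fix v assume v: "v \<in> carrier (left_pow R s)"
    have "v (\<tau> i) \<in> carrier R" if "i \<in> S" for i
      using v \<tau>(1)[OF that] by (auto simp: left_pow_simps)
    then show "\<iota> v \<in> carrier (left_pow R n)"
      by (simp add: \<iota>_def left_pow_simps)
  qed (use \<tau>(1) in \<open>auto simp: \<iota>_def left_pow_simps\<close>)
  have in_P: "h v \<in> P" if "v \<in> carrier (left_pow R n)" "\<And>i. i < n \<Longrightarrow> i \<notin> S \<Longrightarrow> v i = \<zero>\<^bsub>R\<^esub>" for v
  proof (rule hom_image_supported[OF P h(1) \<open>finite S\<close>])
    show "h (std_vec R n i) \<in> P" if "i \<in> S" for i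
      using that by (simp add: S_def)
  qed (use that in auto)
  have in_Q: "h v \<in> Q" if "v \<in> carrier (left_pow R n)" "\<And>i. i \<in> S \<Longrightarrow> v i = \<zero>\<^bsub>R\<^esub>" for v
  proof (rule hom_image_supported[OF Q h(1), of "{..<n} - S"])
    show "h (std_vec R n i) \<in> Q" if "i \<in> {..<n} - S" for i
      using that adapted[of i] by (simp add: S_def)
  qed (use that in auto)
  have hom: "h \<circ> \<iota> \<in> mod_hom R (left_pow R s) M"
    using \<iota> h(1) by (rule mod_hom_compose)
  have into_P: "(h \<circ> \<iota>) w \<in> P" if "w \<in> carrier (left_pow R s)" for w
    unfolding comp_apply using mod_homD(1)[OF \<iota> that] by (rule in_P) (simp add: \<iota>_def)
  have "bij_betw (h \<circ> \<iota>) (carrier (left_pow R s)) P"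
    unfolding bij_betw_def
  proof (intro conjI subset_antisym subsetI)
    have "inj_on \<iota> (carrier (left_pow R s))"
    proof (rule inj_onI)
      fix v w assume v: "v \<in> carrier (left_pow R s)" and w: "w \<in> carrier (left_pow R s)"
        and eq: "\<iota> v = \<iota> w"
      show "v = w"
      proof
        show "v j = w j" for j
          using fun_cong[OF eq, of "\<sigma> j"] \<sigma>'[of j]
            PiE_arb[OF v[unfolded left_pow_simps], of j] PiE_arb[OF w[unfolded left_pow_simps], of j]
          by (cases "j < s") (simp_all add: \<iota>_def)
      qed
    qed
    moreover have "\<iota> ` carrier (left_pow R s) \<subseteq> carrier (left_pow R n)"
      using mod_homD(1)[OF \<iota>] by auto
    ultimately show "inj_on (h \<circ> \<iota>) (carrier (left_pow R s))"
      using bij_betw_imp_inj_on[OF h(2)] by (blast intro: comp_inj_on inj_on_subset)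
  next
    fix x assume "x \<in> (h \<circ> \<iota>) ` carrier (left_pow R s)"
    then show "x \<in> P"
      using into_P by auto
  next
    fix x assume x: "x \<in> P"
    then have "x \<in> h ` carrier (left_pow R n)"
      using P bij_betw_imp_surj_on[OF h(2)] by (auto simp: submodule_iff)
    then obtain v where v: "v \<in> carrier (left_pow R n)" "x = h v"
      by auto
    \<comment> \<open>The coordinates of \<open>x\<close> are split: those at \<open>S\<close>
      contribute an element of \<open>P\<close>, the others an element of \<open>Q\<close>.\<close>
    define vS where "vS = (\<lambda>i\<in>{..<n}. if i \<in> S then v i else \<zero>\<^bsub>R\<^esub>)"
    define vT where "vT = (\<lambda>i\<in>{..<n}. if i \<in> S then \<zero>\<^bsub>R\<^esub> else v i)"
    have v_cl: "v i \<in> carrier R" if "i < n" for i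
      using v(1) that by (auto simp: left_pow_simps)
    then have cl: "vS \<in> carrier (left_pow R n)" "vT \<in> carrier (left_pow R n)"
      by (simp_all add: vS_def vT_def left_pow_simps)
    have "v = vS \<oplus>\<^bsub>left_pow R n\<^esub> vT"
    proof (rule ext)
      fix i
      show "v i = (vS \<oplus>\<^bsub>left_pow R n\<^esub> vT) i"
        using v_cl[of i] PiE_arb[OF v(1)[unfolded left_pow_simps], of i]
        by (cases "i < n") (simp_all add: vS_def vT_def left_pow_simps)
    qed
    then have "x = h vS \<oplus>\<^bsub>M\<^esub> h vT"
      using v(2) mod_homD(2)[OF h(1) cl] by simp
    \<comment> \<open>The trivial decomposition of \<open>x\<close>, to be compared with the one
      given by \<open>vS\<close> and \<open>vT\<close>.\<close>
    moreover have "x = x \<oplus>\<^bsub>M\<^esub> \<zero>\<^bsub>M\<^esub>"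
      using x P by (auto simp: submodule_iff)
    ultimately have eq: "h vS \<oplus>\<^bsub>M\<^esub> h vT = x \<oplus>\<^bsub>M\<^esub> \<zero>\<^bsub>M\<^esub>"
      by metis
    have "h vS \<in> P"
      using cl(1) by (rule in_P) (simp add: vS_def)
    moreover have "h vT \<in> Q"
      using cl(2) by (rule in_Q) (auto simp: vT_def S_def)
    moreover have "\<zero>\<^bsub>M\<^esub> \<in> Q"
      using Q by (simp add: submodule_iff)
    ultimately have "h vS = x"
      using decompose_unique(1)[OF _ _ x _ eq] by simp
    moreover have "vS = \<iota> (\<lambda>j\<in>{..<s}. v (\<sigma> j))"
      by (intro ext) (simp add: vS_def \<iota>_def \<tau>)
    moreover have "(\<lambda>j\<in>{..<s}. v (\<sigma> j)) \<in> carrier (left_pow R s)"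
      using v_cl \<sigma>'(2) by (simp add: left_pow_simps)
    ultimately show "x \<in> (h \<circ> \<iota>) ` carrier (left_pow R s)"
      by (metis comp_apply imageI)
  qed
  moreover have "h \<circ> \<iota> \<in> mod_hom R (left_pow R s) (M\<lparr>carrier := P\<rparr>)"
    using hom into_P by (auto simp: mod_hom_def)
  ultimately show ?thesis
    using left_module_submodule[OF P] by (auto simp: left_free_def)
qed

end

text \<open>The identity map encodes the standard basis, from which the exchange process
  starts.\<close>

lemma left_free_summand:
  assumes "direct_decomposition R (left_pow R n) P Q"
    and unit_sum: "\<And>a b. a \<in> carrier R \<Longrightarrow> b \<in> carrier R \<Longrightarrow> a \<oplus>\<^bsub>R\<^esub> b = \<one>\<^bsub>R\<^esub>
      \<Longrightarrow> a \<in> Units R \<or> b \<in> Units R"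
  shows "left_free R ((left_pow R n)\<lparr>carrier := P\<rparr>)"
proof -
  interpret direct_decomposition R "left_pow R n" P Q by fact
  have "id \<in> mod_hom R (left_pow R n) (left_pow R n)"
    by (simp add: mod_hom_def)
  then obtain h where "h \<in> mod_hom R (left_pow R n) (left_pow R n)"
      "bij_betw h (carrier (left_pow R n)) (carrier (left_pow R n))"
      "\<forall>i<n. h (std_vec R n i) \<in> P \<union> Q"
    using adapted_basis[OF unit_sum _ bij_betw_id order_refl] by metis
  then show ?thesis
    by (intro left_free_adapted) auto
qed

section \<open>Dualities\<close>

text \<open>Inverting twice returns \<open>l\<close> on \<open>L\<close>, and being antitone on
  \<open>L\<close> involves only values there.\<close>

lemma lattice_duality_sym:
  assumes "lattice_duality L L' l"
  shows "lattice_duality L' L (inv_into L l)"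
proof -
  have l: "bij_betw l L L'" "antimono_on L l" "antimono_on L' (inv_into L l)"
    using assms by (auto simp: lattice_duality_def)
  have "inv_into L' (inv_into L l) x = l x" if "x \<in> L" for x
    using inv_into_inv_into_eq[OF l(1) that] .
  then have "antimono_on L (inv_into L' (inv_into L l))"
    using l(2) by (simp add: monotone_on_def)
  then show ?thesis
    using l bij_betw_inv_into[OF l(1)] by (simp add: lattice_duality_def)
qed

text \<open>Reversing inclusions gives
  \<open>l T \<subseteq> l S \<subseteq> l C \<inter> l D\<close>, and \<open>z\<close> lies in
  every member of \<open>L'\<close>. So \<open>l S\<close> and \<open>l T\<close> both equal
  \<open>{z}\<close>, and \<open>l\<close> is injective.\<close>

lemma lattice_duality_disjoint_imp_full:
  assumes l: "lattice_duality L L' l" and CD: "C \<in> L" "D \<in> L" and ST: "S \<in> L" "T \<in> L"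
    and "C \<subseteq> S" "D \<subseteq> S" "S \<subseteq> T"
    and disj: "l C \<inter> l D = {z}" and z: "\<And>K. K \<in> L' \<Longrightarrow> z \<in> K"
  shows "S = T"
proof -
  have bij: "bij_betw l L L'" and anti: "\<And>K Y. K \<in> L \<Longrightarrow> Y \<in> L \<Longrightarrow> K \<subseteq> Y \<Longrightarrow> l Y \<subseteq> l K"
    using l by (auto simp: lattice_duality_def monotone_on_def)
  have "l T \<subseteq> l S" "l S \<subseteq> l C \<inter> l D"
    using CD ST assms(6-8) by (simp_all add: anti)
  moreover have "z \<in> l S" "z \<in> l T"
    using z[of "l S"] z[of "l T"] bij_betwE[OF bij] ST by simp_all
  ultimately have "l S = {z}" "l T = {z}"
    using disj by auto
  then show ?thesis
    using inj_onD[OF bij_betw_imp_inj_on[OF bij] _ ST] by simp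
qed

text \<open>The preceding lemma is applied to the sum of \<open>C\<close> and \<open>D\<close>
  inside the whole module. The target lattice stays abstract, so that both the duality and its
  inverse fit.\<close>

lemma direct_decomposition_dual:
  assumes M: "left_module R M"
    and l: "lattice_duality (left_submodules R M) L' l"
    and CD: "C \<in> left_submodules R M" "D \<in> left_submodules R M"
    and CD0: "C \<inter> D = {\<zero>\<^bsub>M\<^esub>}"
    and disj: "l C \<inter> l D = {z}" and z: "\<And>K. K \<in> L' \<Longrightarrow> z \<in> K"
  shows "direct_decomposition R M C D"
proof -
  interpret left_module R M by fact
  have C: "submodule C R M" and D: "submodule D R M"
    using CD by (auto simp: left_submodules_def)
  have S: "submodule (C <+>\<^bsub>M\<^esub> D) R M"
    using submodule_sum(1)[OF C D] .
  have "C <+>\<^bsub>M\<^esub> D = carrier M"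
    using l CD
  proof (rule lattice_duality_disjoint_imp_full)
    show "C <+>\<^bsub>M\<^esub> D \<in> left_submodules R M" "carrier M \<in> left_submodules R M"
      using S submodule_carrier by (auto simp: left_submodules_def)
    show "C \<subseteq> C <+>\<^bsub>M\<^esub> D" "D \<subseteq> C <+>\<^bsub>M\<^esub> D" "C <+>\<^bsub>M\<^esub> D \<subseteq> carrier M"
      using submodule_sum(2,3)[OF C D] S by (simp_all add: submodule_iff)
    show "l C \<inter> l D = {z}" by (fact disj)
    show "z \<in> K" if "K \<in> L'" for K using that by (fact z)
  qed
  then show ?thesis
    by (intro direct_decomposition.intro direct_decomposition_axioms.intro
        left_module_axioms C D CD0)
qed

lemma Units_opp: "Units (opp R) = Units R"
  by (auto simp: Units_def)

theorem theorem10: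
  fixes R :: "('a, 'r) ring_scheme" and n :: nat
    and l r :: "(nat \<Rightarrow> 'a) set \<Rightarrow> (nat \<Rightarrow> 'a) set" and C :: "(nat \<Rightarrow> 'a) set"
  assumes "ring R" and "n > 0"
    and "lattice_duality (right_submodules R (right_pow R n)) (left_submodules R (left_pow R n)) l"
    and "\<And>D. D \<in> left_submodules R (left_pow R n) \<Longrightarrow>
           r D = inv_into (right_submodules R (right_pow R n)) l D"
    and "C \<in> left_submodules R (left_pow R n)" and "C \<in> right_submodules R (right_pow R n)"
    and "l C \<inter> C = {\<zero>\<^bsub>left_pow R n\<^esub>}" and "C \<inter> r C = {\<zero>\<^bsub>right_pow R n\<^esub>}"
  shows "right_projective TYPE('m) TYPE('k) R ((right_pow R n)\<lparr>carrier := C\<rparr>) \<and>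
         left_projective TYPE('m) TYPE('k) R ((left_pow R n)\<lparr>carrier := C\<rparr>) \<and>
         (local_ring R \<longrightarrow>
            right_free R ((right_pow R n)\<lparr>carrier := C\<rparr>) \<and>
            left_free R ((left_pow R n)\<lparr>carrier := C\<rparr>))"
proof -
  interpret ring R by fact
  interpret opp: ring "opp R" by (rule ring_opp)
  let ?RM = "right_pow R n" and ?LM = "left_pow R n"
  let ?LR = "right_submodules R ?RM" and ?LL = "left_submodules R ?LM"
  interpret LM: left_module R ?LM by (rule left_module_left_pow)
  interpret RM: left_module "opp R" ?RM by (rule left_module_right_pow)
  have l: "lattice_duality ?LR ?LL l" and rC: "r C = inv_into ?LR l C"
    using assms(3,4,5) by auto
  have bij: "bij_betw l ?LR ?LL"
    using l by (simp add: lattice_duality_def)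
  have lC: "l C \<in> ?LL" and rC_mem: "r C \<in> ?LR"
    using bij_betwE[OF bij] bij_betwE[OF bij_betw_inv_into[OF bij]] assms(5,6) rC by auto
  \<comment> \<open>These equations turn \<open>l C \<inter> C\<close> into an intersection of
    images under \<open>l\<close>, and \<open>C \<inter> r C\<close> into one of images under the
    inverse of \<open>l\<close>.\<close>
  have lrC: "l (r C) = C" and rlC: "inv_into ?LR l (l C) = C"
    using bij_betw_inv_into_right[OF bij assms(5)] bij_betw_inv_into_left[OF bij assms(6)] rC
    by auto
  \<comment> \<open>On the right, \<open>C \<inter> r C = 0\<close> makes the sum direct, and
    \<open>l C \<inter> C = 0\<close> makes it everything.\<close>
  have right: "direct_decomposition (opp R) (left_pow (opp R) n) C (r C)"
    unfolding right_pow_def[symmetric]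
  proof (rule direct_decomposition_dual)
    show "lattice_duality (left_submodules (opp R) ?RM) ?LL l"
      using l by (simp add: right_submodules_def)
    show "l C \<inter> l (r C) = {\<zero>\<^bsub>?LM\<^esub>}"
      using assms(7) lrC by simp
    show "\<zero>\<^bsub>?LM\<^esub> \<in> K" if "K \<in> ?LL" for K
      using that by (simp add: left_submodules_def LM.submodule_iff)
  qed (use assms(6,8) rC_mem in \<open>simp_all add: right_submodules_def RM.left_module_axioms\<close>)
  \<comment> \<open>On the left the two hypotheses exchange roles, with the inverse of
    \<open>l\<close> as the duality.\<close>
  have left: "direct_decomposition R ?LM C (l C)"
  proof (rule direct_decomposition_dual)
    show "lattice_duality ?LL ?LR (inv_into ?LR l)"
      using l by (rule lattice_duality_sym)
    show "inv_into ?LR l C \<inter> inv_into ?LR l (l C) = {\<zero>\<^bsub>?RM\<^esub>}"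
      using assms(8) rC rlC by auto
    show "\<zero>\<^bsub>?RM\<^esub> \<in> K" if "K \<in> ?LR" for K
      using that by (simp add: right_submodules_def left_submodules_def RM.submodule_iff)
  qed (use assms(5,7) lC in \<open>auto simp: LM.left_module_axioms\<close>)
  show ?thesis
  proof (intro conjI impI)
    show "right_projective TYPE('m) TYPE('k) R (?RM\<lparr>carrier := C\<rparr>)"
      using left_projective_summand[OF right] by (simp add: right_projective_def right_pow_def)
    show "left_projective TYPE('m) TYPE('k) R (?LM\<lparr>carrier := C\<rparr>)"
      using left_projective_summand[OF left] .
  next
    assume "local_ring R"
    \<comment> \<open>Addition, one and units of \<open>opp R\<close> are those of \<open>R\<close>,
      so this single fact serves both sides.\<close>
    note unit_sum = local_ring_unit_sum[OF this]
    show "right_free R (?RM\<lparr>carrier := C\<rparr>)"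
      using left_free_summand[OF right] unit_sum
      by (simp add: right_free_def right_pow_def Units_opp)
    show "left_free R (?LM\<lparr>carrier := C\<rparr>)"
      using left_free_summand[OF left] unit_sum by blast
  qed
qed

end
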